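(* Let $Y_1,Y_2$ be compact length spaces with $d_{GH}(Y_1,Y_2)\le\epsilon$. Then for any $\delta_1>20\epsilon$ and $\delta_2>\delta_1+10\epsilon$ there exists a surjective homomorphism $\Phi:G(Y_1,\delta_1)\to G(Y_2,\delta_2)$.
   Context: For a connected, locally path connected length space $Y$, $p\in Y$ and $\delta>0$, $\pi_1(Y,\delta,p)$ is the normal subgroup of $\pi_1(Y,p)$ generated by the homotopy classes of loops $\alpha^{-1}\circ\beta\circ\alpha$, where $\beta$ is a closed path contained in some open ball of radius $\delta$ and $\alpha$ is a path from $p$ to $\beta(0)$; $G(Y,\delta)=\pi_1(Y,p)/\pi_1(Y,\delta,p)$, the deck transformation group of the corresponding covering (the $\delta$-cover), which up to isomorphism does not depend on $p$. $d_{GH}$ is the Gromov–Hausdorff distance. *)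

theory Defs
  imports "HOL-Analysis.Analysis" "HOL-Algebra.Algebra"
begin

definition curve_length :: "(real \<Rightarrow> 'a::metric_space) \<Rightarrow> ereal" where
  "curve_length g = (SUP (n, t) \<in> {(n, t). t 0 = 0 \<and> t n = 1 \<and> (\<forall>i<n. t i \<le> t (Suc i))}.
       ereal (\<Sum>i<n. dist (g (t i)) (g (t (Suc i)))))"

definition length_space :: "'a::metric_space set \<Rightarrow> bool" where
  "length_space Y \<longleftrightarrow> (\<forall>x\<in>Y. \<forall>y\<in>Y.
     ereal (dist x y) = (INF g \<in> {g. path g \<and> path_image g \<subseteq> Y \<and> pathstart g = x \<and> pathfinish g = y}.
                           curve_length g))"

definition hausdorff_dist_gen :: "('c \<Rightarrow> 'c \<Rightarrow> real) \<Rightarrow> 'c set \<Rightarrow> 'c set \<Rightarrow> real" where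
  "hausdorff_dist_gen d A B =
     max (SUP a\<in>A. INF b\<in>B. d a b) (SUP b\<in>B. INF a\<in>A. d a b)"

definition admissible_metric ::
  "'a::metric_space set \<Rightarrow> 'b::metric_space set \<Rightarrow> ('a + 'b \<Rightarrow> 'a + 'b \<Rightarrow> real) \<Rightarrow> bool" where
  "admissible_metric Y1 Y2 d \<longleftrightarrow> Metric_space (Inl ` Y1 \<union> Inr ` Y2) d \<and>
     (\<forall>x\<in>Y1. \<forall>y\<in>Y1. d (Inl x) (Inl y) = dist x y) \<and>
     (\<forall>x\<in>Y2. \<forall>y\<in>Y2. d (Inr x) (Inr y) = dist x y)"

definition GH_dist :: "'a::metric_space set \<Rightarrow> 'b::metric_space set \<Rightarrow> real" where
  "GH_dist Y1 Y2 = Inf {hausdorff_dist_gen d (Inl ` Y1) (Inr ` Y2) | d. admissible_metric Y1 Y2 d}"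

definition loops_at :: "'a::topological_space set \<Rightarrow> 'a \<Rightarrow> (real \<Rightarrow> 'a) set" where
  "loops_at Y p = {g. path g \<and> path_image g \<subseteq> Y \<and> pathstart g = p \<and> pathfinish g = p}"

definition path_class :: "'a::topological_space set \<Rightarrow> (real \<Rightarrow> 'a) \<Rightarrow> (real \<Rightarrow> 'a) set" where
  "path_class Y g = {h. homotopic_paths Y g h}"

definition fundamental_group :: "'a::topological_space set \<Rightarrow> 'a \<Rightarrow> (real \<Rightarrow> 'a) set monoid" where
  "fundamental_group Y p =
     \<lparr> carrier = path_class Y ` loops_at Y p,
       mult = (\<lambda>A B. path_class Y ((SOME a. a \<in> A) +++ (SOME b. b \<in> B))),
       one = path_class Y (\<lambda>t. p) \<rparr>"

definition normal_closure :: "('g, 'm) monoid_scheme \<Rightarrow> 'g set \<Rightarrow> 'g set" where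
  "normal_closure G S = \<Inter> {H. normal H G \<and> S \<subseteq> H}"

definition small_loop_subgroup :: "'a::metric_space set \<Rightarrow> real \<Rightarrow> 'a \<Rightarrow> (real \<Rightarrow> 'a) set set" where
  "small_loop_subgroup Y \<delta> p = normal_closure (fundamental_group Y p)
     {path_class Y (\<alpha> +++ \<beta> +++ reversepath \<alpha>) | \<alpha> \<beta>.
        path \<beta> \<and> pathfinish \<beta> = pathstart \<beta> \<and>
        (\<exists>c\<in>Y. path_image \<beta> \<subseteq> Y \<inter> ball c \<delta>) \<and>
        path \<alpha> \<and> path_image \<alpha> \<subseteq> Y \<and> pathstart \<alpha> = p \<and> pathfinish \<alpha> = pathstart \<beta>}"

definition delta_group :: "'a::metric_space set \<Rightarrow> real \<Rightarrow> 'a \<Rightarrow> (real \<Rightarrow> 'a) set set monoid" where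
  "delta_group Y \<delta> p = fundamental_group Y p Mod small_loop_subgroup Y \<delta> p"

end

theory Submission
  imports Defs
begin

text \<open>A Gromov-Hausdorff approximation gives, for a suitable \<open>e > \<epsilon>\<close>, coarse maps \<open>f : Y1 \<rightarrow> Y2\<close> and
  \<open>g : Y2 \<rightarrow> Y1\<close> distorting distances by less than \<open>2 e\<close>. Joining \<open>f x\<close> to \<open>f x'\<close> by a
  short path whenever \<open>dist x x' < e\<close> yields an element of \<open>G(Y2, \<delta>2)\<close>; these elements satisfy the
  cocycle identity on triples of small diameter because loops in \<open>\<delta>2\<close>-balls are killed. Multiplying
  the cocycle along fine subdivisions of a path in \<open>Y1\<close> is independent of the subdivision and invariant
  under homotopy, so it defines a homomorphism from the fundamental group of \<open>Y1\<close>. A loop in a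
  \<open>\<delta>1\<close>-ball is shadowed by a loop in a ball of radius \<open>\<delta>1 + 5 e\<close> and hence has trivial value.
  For surjectivity, a path in \<open>Y2\<close> is cut into short pieces, the cutting points are
  moved to \<open>Y1\<close> by \<open>g\<close> and joined there by short paths.\<close>

definition paths_in :: "'a::topological_space set \<Rightarrow> (real \<Rightarrow> 'a) set" where
  "paths_in Y = {g. path g \<and> path_image g \<subseteq> Y}"

lemma paths_inD:
  assumes "g \<in> paths_in Y"
  shows "path g" "path_image g \<subseteq> Y" "pathstart g \<in> Y" "pathfinish g \<in> Y"
  using assms unfolding paths_in_def by (auto simp: pathstart_def pathfinish_def path_image_def)

lemma paths_in_mono: "g \<in> paths_in Z \<Longrightarrow> Z \<subseteq> Y \<Longrightarrow> g \<in> paths_in Y"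
  by (auto simp: paths_in_def)

lemma paths_in_join [simp, intro]:
  "g \<in> paths_in Y \<Longrightarrow> h \<in> paths_in Y \<Longrightarrow> pathfinish g = pathstart h \<Longrightarrow> g +++ h \<in> paths_in Y"
  by (auto simp: paths_in_def dest: path_image_join_subset[THEN subsetD])

lemma paths_in_reversepath [simp, intro]: "g \<in> paths_in Y \<Longrightarrow> reversepath g \<in> paths_in Y"
  by (auto simp: paths_in_def)

lemma paths_in_const [simp, intro]: "a \<in> Y \<Longrightarrow> (\<lambda>_. a) \<in> paths_in Y"
  by (auto simp: paths_in_def path_def path_image_def)

lemma pathstart_const [simp]: "pathstart (\<lambda>_. a) = a"
  and pathfinish_const [simp]: "pathfinish (\<lambda>_. a) = a"
  by (auto simp: pathstart_def pathfinish_def)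

text \<open>The unit and inverse laws of the library are restricted to normed spaces because they
  use straight lines; every path is the image of the path \<open>linepath 0 1\<close> on the real line.\<close>

lemma homotopic_paths_real_image:
  assumes "g \<in> paths_in Y" "homotopic_paths {0..1} p q"
  shows "homotopic_paths Y (g \<circ> p) (g \<circ> q)"
  using assms by (intro homotopic_paths_continuous_image[of "{0..1}"])
    (auto simp: paths_in_def path_def path_image_def)

lemma homotopic_paths_const_right:
  assumes "g \<in> paths_in Y"
  shows "homotopic_paths Y (g +++ (\<lambda>_. pathfinish g)) g"
proof -
  have "homotopic_paths {0..1::real} (linepath 0 1 +++ linepath 1 1) (linepath 0 1)"
    by (rule homotopic_paths_rid') (auto simp: path_image_linepath closed_segment_eq_real_ivl)
  from homotopic_paths_real_image[OF assms this] show ?thesis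
    by (simp add: linepath_def joinpaths_def pathfinish_def o_def if_distrib cong: if_cong)
qed

lemma homotopic_paths_const_left:
  assumes "g \<in> paths_in Y"
  shows "homotopic_paths Y ((\<lambda>_. pathstart g) +++ g) g"
proof -
  have "homotopic_paths {0..1::real} (linepath 0 0 +++ linepath 0 1) (linepath 0 1)"
    by (rule homotopic_paths_lid') (auto simp: path_image_linepath closed_segment_eq_real_ivl)
  from homotopic_paths_real_image[OF assms this] show ?thesis
    by (simp add: linepath_def joinpaths_def pathstart_def o_def if_distrib cong: if_cong)
qed

lemma homotopic_paths_reverse_right:
  assumes "g \<in> paths_in Y"
  shows "homotopic_paths Y (g +++ reversepath g) (\<lambda>_. pathstart g)"
proof -
  have "homotopic_paths {0..1::real} (linepath 0 1 +++ reversepath (linepath 0 1)) (linepath 0 0)"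
    using homotopic_paths_rinv[of "linepath 0 (1::real)" "{0..1}"]
    by (auto simp: path_image_linepath closed_segment_eq_real_ivl)
  from homotopic_paths_real_image[OF assms this] show ?thesis
    by (simp add: linepath_def joinpaths_def pathstart_def reversepath_def o_def if_distrib cong: if_cong)
qed

lemma homotopic_paths_reverse_left:
  assumes "g \<in> paths_in Y"
  shows "homotopic_paths Y (reversepath g +++ g) (\<lambda>_. pathfinish g)"
  using homotopic_paths_reverse_right[OF paths_in_reversepath[OF assms]] by simp

lemma homotopic_paths_in:
  "homotopic_paths Y g h \<Longrightarrow> g \<in> paths_in Y" "homotopic_paths Y g h \<Longrightarrow> h \<in> paths_in Y"
  using homotopic_paths_imp_path homotopic_paths_imp_subset by (force simp: paths_in_def)+

lemma homotopic_paths_refl_in: "g \<in> paths_in Y \<Longrightarrow> homotopic_paths Y g g"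
  by (simp add: paths_in_def)

lemma homotopic_paths_assoc_in:
  "\<lbrakk>f \<in> paths_in Y; g \<in> paths_in Y; h \<in> paths_in Y; pathfinish f = pathstart g;
    pathfinish g = pathstart h\<rbrakk> \<Longrightarrow> homotopic_paths Y (f +++ g +++ h) ((f +++ g) +++ h)"
  by (simp add: paths_in_def homotopic_paths_assoc)

lemma loops_at_iff:
  "g \<in> loops_at Y p \<longleftrightarrow> g \<in> paths_in Y \<and> pathstart g = p \<and> pathfinish g = p"
  by (auto simp: loops_at_def paths_in_def)

lemma path_class_cong: "homotopic_paths Y g h \<Longrightarrow> path_class Y g = path_class Y h"
  by (auto simp: path_class_def intro: homotopic_paths_trans homotopic_paths_sym)

lemma homotopic_some_path_class:
  "g \<in> paths_in Y \<Longrightarrow> homotopic_paths Y g (SOME h. h \<in> path_class Y g)"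
  by (rule someI2[of _ g]) (auto simp: path_class_def paths_in_def)

lemma carrier_fundamental_group: "carrier (fundamental_group Y p) = path_class Y ` loops_at Y p"
  by (simp add: fundamental_group_def)

lemma path_class_const: "\<one>\<^bsub>fundamental_group Y p\<^esub> = path_class Y (\<lambda>_. p)"
  by (simp add: fundamental_group_def)

lemma path_class_join:
  assumes "g \<in> loops_at Y p" "h \<in> loops_at Y p"
  shows "path_class Y g \<otimes>\<^bsub>fundamental_group Y p\<^esub> path_class Y h = path_class Y (g +++ h)"
proof -
  have "homotopic_paths Y (g +++ h)
     ((SOME a. a \<in> path_class Y g) +++ (SOME a. a \<in> path_class Y h))"
    using assms by (intro homotopic_paths_join homotopic_some_path_class) (auto simp: loops_at_iff)
  from path_class_cong[OF this] show ?thesis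
    by (simp add: fundamental_group_def)
qed

lemma loops_at_join: "g \<in> loops_at Y p \<Longrightarrow> h \<in> loops_at Y p \<Longrightarrow> g +++ h \<in> loops_at Y p"
  by (auto simp: loops_at_iff)

lemma group_fundamental_group:
  assumes "p \<in> Y"
  shows "group (fundamental_group Y p)"
proof (rule groupI)
  fix x y z
  assume "x \<in> carrier (fundamental_group Y p)" "y \<in> carrier (fundamental_group Y p)"
    "z \<in> carrier (fundamental_group Y p)"
  then obtain f g h where *: "f \<in> loops_at Y p" "g \<in> loops_at Y p" "h \<in> loops_at Y p"
    "x = path_class Y f" "y = path_class Y g" "z = path_class Y h"
    by (auto simp: carrier_fundamental_group)
  show "x \<otimes>\<^bsub>fundamental_group Y p\<^esub> y \<in> carrier (fundamental_group Y p)"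
    using * by (auto simp: path_class_join loops_at_join carrier_fundamental_group)
  show "x \<otimes>\<^bsub>fundamental_group Y p\<^esub> y \<otimes>\<^bsub>fundamental_group Y p\<^esub> z =
        x \<otimes>\<^bsub>fundamental_group Y p\<^esub> (y \<otimes>\<^bsub>fundamental_group Y p\<^esub> z)"
    using * homotopic_paths_assoc_in[of f Y g h]
    by (simp add: path_class_join loops_at_join)
      (auto simp: loops_at_iff intro!: path_class_cong intro: homotopic_paths_sym)
next
  fix x assume "x \<in> carrier (fundamental_group Y p)"
  then obtain g where g: "g \<in> loops_at Y p" "x = path_class Y g"
    by (auto simp: carrier_fundamental_group)
  have c: "(\<lambda>_. p) \<in> loops_at Y p"
    using assms by (auto simp: loops_at_iff)
  show "\<one>\<^bsub>fundamental_group Y p\<^esub> \<otimes>\<^bsub>fundamental_group Y p\<^esub> x = x"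
    using g c homotopic_paths_const_left[of g Y] unfolding path_class_const
    by (auto simp: path_class_join loops_at_iff intro!: path_class_cong)
  have "reversepath g \<in> loops_at Y p"
    using g by (auto simp: loops_at_iff)
  moreover have "path_class Y (reversepath g) \<otimes>\<^bsub>fundamental_group Y p\<^esub> x = \<one>\<^bsub>fundamental_group Y p\<^esub>"
    using g calculation homotopic_paths_reverse_left[of g Y] unfolding path_class_const g(2)
    by (subst path_class_join) (auto simp: loops_at_iff intro!: path_class_cong)
  ultimately show "\<exists>y\<in>carrier (fundamental_group Y p). y \<otimes>\<^bsub>fundamental_group Y p\<^esub> x = \<one>\<^bsub>fundamental_group Y p\<^esub>"
    by (auto simp: carrier_fundamental_group)
qed (use assms in \<open>auto simp: path_class_const carrier_fundamental_group loops_at_iff\<close>)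

lemma (in group) normal_Inter:
  assumes "\<And>H. H \<in> \<H> \<Longrightarrow> H \<lhd> G" "\<H> \<noteq> {}"
  shows "\<Inter>\<H> \<lhd> G"
  using assms unfolding normal_inv_iff by (auto intro!: subgroups_Inter)

lemma (in group) normal_carrier: "carrier G \<lhd> G"
  using normal_inv_iff subgroup_self by auto

lemma (in group) normal_normal_closure: "S \<subseteq> carrier G \<Longrightarrow> normal_closure G S \<lhd> G"
  unfolding normal_closure_def by (rule normal_Inter) (use normal_carrier in auto)

lemma normal_closure_incl: "S \<subseteq> normal_closure G S"
  by (auto simp: normal_closure_def)

lemma normal_closure_minimal: "H \<lhd> G \<Longrightarrow> S \<subseteq> H \<Longrightarrow> normal_closure G S \<subseteq> H"
  by (auto simp: normal_closure_def)

lemma small_loop_subgroup_alt: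
  "small_loop_subgroup Y \<delta> p = normal_closure (fundamental_group Y p)
     {path_class Y (\<alpha> +++ \<beta> +++ reversepath \<alpha>) | \<alpha> \<beta> c.
        c \<in> Y \<and> \<beta> \<in> paths_in (Y \<inter> ball c \<delta>) \<and> pathfinish \<beta> = pathstart \<beta> \<and>
        \<alpha> \<in> paths_in Y \<and> pathstart \<alpha> = p \<and> pathfinish \<alpha> = pathstart \<beta>}"
  unfolding small_loop_subgroup_def
  unfolding paths_in_def mem_Collect_eq
  by (rule arg_cong[of _ _ "normal_closure _"], rule Collect_cong) blast

lemma lasso_in_loops_at:
  assumes "\<alpha> \<in> paths_in Y" "pathstart \<alpha> = p" "pathfinish \<alpha> = pathstart \<beta>" "\<beta> \<in> paths_in Y"
    "pathfinish \<beta> = pathstart \<beta>"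
  shows "\<alpha> +++ \<beta> +++ reversepath \<alpha> \<in> loops_at Y p"
  using assms by (auto simp: loops_at_iff)

lemma normal_small_loop_subgroup:
  assumes "p \<in> Y"
  shows "small_loop_subgroup Y \<delta> p \<lhd> fundamental_group Y p"
  unfolding small_loop_subgroup_alt
  by (rule group.normal_normal_closure[OF group_fundamental_group[OF assms]])
    (auto simp: carrier_fundamental_group intro!: imageI lasso_in_loops_at intro: paths_in_mono)

lemma group_delta_group: "p \<in> Y \<Longrightarrow> group (delta_group Y \<delta> p)"
  unfolding delta_group_def using normal.factorgroup_is_group normal_small_loop_subgroup by blast

locale path_functor = group G for G :: "('g, 'm) monoid_scheme" (structure) +
  fixes Y :: "'a::topological_space set" and E :: "(real \<Rightarrow> 'a) \<Rightarrow> 'g"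
  assumes closed [simp, intro]: "g \<in> paths_in Y \<Longrightarrow> E g \<in> carrier G"
    and join: "\<lbrakk>g \<in> paths_in Y; h \<in> paths_in Y; pathfinish g = pathstart h\<rbrakk>
                 \<Longrightarrow> E (g +++ h) = E g \<otimes> E h"
    and homotopic: "homotopic_paths Y g h \<Longrightarrow> E g = E h"
begin

lemma const:
  assumes "a \<in> Y"
  shows "E (\<lambda>_. a) = \<one>"
proof -
  have "E (\<lambda>_. a) \<otimes> E (\<lambda>_. a) = E (\<lambda>_. a)"
    using join[of "\<lambda>_. a" "\<lambda>_. a"] homotopic[OF homotopic_paths_const_right[of "\<lambda>_. a"]] assms
    by auto
  then show ?thesis
    using assms by (simp add: paths_in_const l_cancel_one)
qed

lemma reverse:
  assumes "g \<in> paths_in Y"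
  shows "E (reversepath g) = inv (E g)"
proof -
  have "E (reversepath g) \<otimes> E g = E (reversepath g +++ g)"
    using assms by (intro join[symmetric]) auto
  also have "\<dots> = E (\<lambda>_. pathfinish g)"
    by (rule homotopic[OF homotopic_paths_reverse_left[OF assms]])
  also have "\<dots> = \<one>"
    using assms by (simp add: const paths_inD)
  finally show ?thesis
    using assms by (simp add: paths_in_reversepath inv_equality)
qed

lemma lasso:
  assumes "\<alpha> \<in> paths_in Y" "pathfinish \<alpha> = pathstart \<beta>" "\<beta> \<in> paths_in Y"
    "pathfinish \<beta> = pathfinish \<alpha>"
  shows "E (\<alpha> +++ \<beta> +++ reversepath \<alpha>) = E \<alpha> \<otimes> E \<beta> \<otimes> inv (E \<alpha>)"
  using assms by (simp add: join paths_in_join paths_in_reversepath reverse m_assoc)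

end

lemma path_functor_hom_delta_group:
  fixes Y :: "'a::metric_space set" and G (structure)
  assumes "path_functor G Y E" and p: "p \<in> Y"
    and small: "\<And>c \<beta>. \<lbrakk>c \<in> Y; \<beta> \<in> paths_in (Y \<inter> ball c \<delta>); pathfinish \<beta> = pathstart \<beta>\<rbrakk> \<Longrightarrow> E \<beta> = \<one>"
  shows "\<exists>\<Phi> \<in> hom (delta_group Y \<delta> p) G. \<Phi> ` carrier (delta_group Y \<delta> p) = E ` loops_at Y p"
proof -
  interpret path_functor G Y E by fact
  let ?\<pi> = "fundamental_group Y p"
  define \<phi> where "\<phi> A = E (SOME g. g \<in> A)" for A
  have \<phi>: "\<phi> (path_class Y g) = E g" if "g \<in> loops_at Y p" for g
    using homotopic[OF homotopic_some_path_class[of g Y]] that by (simp add: \<phi>_def loops_at_iff)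
  have "\<phi> \<in> hom ?\<pi> G"
    by (rule homI) (auto simp: carrier_fundamental_group path_class_join \<phi> loops_at_join,
        auto simp: loops_at_iff join)
  then interpret \<phi>: group_hom ?\<pi> G \<phi>
    by (intro group_hom.intro group_hom_axioms.intro group_fundamental_group p is_group)
  have "path_class Y (\<alpha> +++ \<beta> +++ reversepath \<alpha>) \<in> kernel ?\<pi> G \<phi>"
    if "c \<in> Y" "\<beta> \<in> paths_in (Y \<inter> ball c \<delta>)" "pathfinish \<beta> = pathstart \<beta>"
      "\<alpha> \<in> paths_in Y" "pathstart \<alpha> = p" "pathfinish \<alpha> = pathstart \<beta>" for c \<alpha> \<beta>
  proof -
    have \<beta>: "\<beta> \<in> paths_in Y"
      using that by (auto intro: paths_in_mono)
    have l: "\<alpha> +++ \<beta> +++ reversepath \<alpha> \<in> loops_at Y p"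
      using that \<beta> by (intro lasso_in_loops_at) auto
    show ?thesis
      using that \<beta> l by (auto simp: kernel_def carrier_fundamental_group \<phi> lasso small)
  qed
  then have "small_loop_subgroup Y \<delta> p \<subseteq> kernel ?\<pi> G \<phi>"
    unfolding small_loop_subgroup_alt
    by (intro normal_closure_minimal \<phi>.normal_kernel) blast
  from \<phi>.FactGroup_universal_kernel[OF normal_small_loop_subgroup[OF p] this]
  obtain \<Phi> where \<Phi>: "\<Phi> \<in> hom (delta_group Y \<delta> p) G"
    "\<And>x. x \<in> carrier ?\<pi> \<Longrightarrow> \<Phi> (small_loop_subgroup Y \<delta> p #>\<^bsub>?\<pi>\<^esub> x) = \<phi> x"
    unfolding delta_group_def by blast
  have "\<Phi> ` carrier (delta_group Y \<delta> p) = \<phi> ` path_class Y ` loops_at Y p"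
    using \<Phi>(2) by (auto simp: delta_group_def carrier_FactGroup carrier_fundamental_group image_image)
  also have "\<dots> = E ` loops_at Y p"
    by (simp add: image_image \<phi>)
  finally show ?thesis using \<Phi>(1) by blast
qed

lemma homotopic_paths_cancel_middle:
  assumes "f \<in> paths_in Y" "g \<in> paths_in Y" "h \<in> paths_in Y" "k \<in> paths_in Y" "t \<in> paths_in Y"
    and "pathfinish f = pathstart g" "pathfinish g = pathfinish t" "pathfinish t = pathstart h"
      "pathfinish h = pathstart k"
  shows "homotopic_paths Y ((f +++ g +++ reversepath t) +++ (t +++ h +++ k)) (f +++ (g +++ h) +++ k)"
proof -
  let ?r = "reversepath t"
  have "homotopic_paths Y ((f +++ g +++ ?r) +++ (t +++ h +++ k)) (f +++ (g +++ ?r) +++ t +++ h +++ k)"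
    using assms by (intro homotopic_paths_sym[OF homotopic_paths_assoc_in]) auto
  also have "homotopic_paths Y \<dots> (f +++ g +++ ?r +++ t +++ h +++ k)"
    using assms by (intro homotopic_paths_join homotopic_paths_refl_in
        homotopic_paths_sym[OF homotopic_paths_assoc_in]) auto
  also have "homotopic_paths Y \<dots> (f +++ g +++ (?r +++ t) +++ h +++ k)"
    using assms by (intro homotopic_paths_join homotopic_paths_refl_in homotopic_paths_assoc_in) auto
  also have "homotopic_paths Y \<dots> (f +++ g +++ (\<lambda>_. pathfinish t) +++ h +++ k)"
    using assms by (intro homotopic_paths_join homotopic_paths_refl_in homotopic_paths_reverse_left) auto
  also have "homotopic_paths Y \<dots> (f +++ g +++ h +++ k)"
    using assms homotopic_paths_const_left[of "h +++ k" Y]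
    by (intro homotopic_paths_join[OF homotopic_paths_refl_in]) auto
  also have "homotopic_paths Y \<dots> (f +++ (g +++ h) +++ k)"
    using assms by (intro homotopic_paths_join homotopic_paths_refl_in homotopic_paths_assoc_in) auto
  finally show ?thesis .
qed

text \<open>Paths with arbitrary end points are turned into loops by attaching fixed tails to the
  base point, so the quotient map extends from loops to the whole fundamental groupoid.\<close>

lemma delta_group_path_functor:
  fixes Y :: "'a::metric_space set"
  assumes "path_connected Y" and p: "p \<in> Y"
  obtains E where "path_functor (delta_group Y \<delta> p) Y E"
    and "E ` loops_at Y p = carrier (delta_group Y \<delta> p)"
    and "\<And>c g h. \<lbrakk>c \<in> Y; g \<in> paths_in (Y \<inter> ball c \<delta>); h \<in> paths_in (Y \<inter> ball c \<delta>);
            pathstart g = pathstart h; pathfinish g = pathfinish h\<rbrakk> \<Longrightarrow> E g = E h"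
proof -
  let ?\<pi> = "fundamental_group Y p" and ?N = "small_loop_subgroup Y \<delta> p"
  let ?G = "delta_group Y \<delta> p"
  interpret N: normal ?N ?\<pi> by (rule normal_small_loop_subgroup[OF p])
  interpret G: group ?G by (rule group_delta_group[OF p])
  define K where "K g = ?N #>\<^bsub>?\<pi>\<^esub> path_class Y g" for g
  have carrier: "carrier ?G = K ` loops_at Y p"
    by (simp add: delta_group_def carrier_FactGroup carrier_fundamental_group K_def image_image)
  have K_join: "K (g +++ h) = K g \<otimes>\<^bsub>?G\<^esub> K h" if "g \<in> loops_at Y p" "h \<in> loops_at Y p" for g h
    using that by (auto simp: K_def delta_group_def carrier_fundamental_group N.rcos_sum path_class_join)
  have K_homotopic: "K g = K h" if "homotopic_paths Y g h" for g h
    using path_class_cong[OF that] by (simp add: K_def)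
  have "\<exists>t. t \<in> paths_in Y \<and> pathstart t = p \<and> pathfinish t = x \<and> (x = p \<longrightarrow> t = (\<lambda>_. p))"
    if "x \<in> Y" for x
    using assms that unfolding path_connected_def paths_in_def
    by (cases "x = p") (auto intro!: exI[of _ "\<lambda>_. p"] simp: path_def path_image_def)
  then obtain \<tau> where \<tau>: "\<And>x. x \<in> Y \<Longrightarrow> \<tau> x \<in> paths_in Y" "\<And>x. x \<in> Y \<Longrightarrow> pathstart (\<tau> x) = p"
    "\<And>x. x \<in> Y \<Longrightarrow> pathfinish (\<tau> x) = x" "\<tau> p = (\<lambda>_. p)"
    using p by metis
  define L where "L g = \<tau> (pathstart g) +++ g +++ reversepath (\<tau> (pathfinish g))" for g
  define E where "E g = K (L g)" for g
  have L: "L g \<in> loops_at Y p" if "g \<in> paths_in Y" for g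
    using that paths_inD[OF that] by (auto simp: L_def loops_at_iff \<tau>)
  have E_functor: "path_functor ?G Y E"
  proof
    fix g h assume g: "g \<in> paths_in Y"
    then show "E g \<in> carrier ?G"
      by (simp add: E_def carrier L)
    assume h: "h \<in> paths_in Y" "pathfinish g = pathstart h"
    have "homotopic_paths Y (L g +++ L h) (L (g +++ h))"
      using g h paths_inD[OF g] paths_inD[OF h(1)] homotopic_paths_cancel_middle
        [of "\<tau> (pathstart g)" Y g h "reversepath (\<tau> (pathfinish h))" "\<tau> (pathstart h)"]
      by (simp add: L_def \<tau>)
    from K_homotopic[OF this] show "E (g +++ h) = E g \<otimes>\<^bsub>?G\<^esub> E h"
      using g h by (simp add: E_def K_join L)
  next
    fix g h assume "homotopic_paths Y g h"
    moreover from homotopic_paths_in[OF this] have "g \<in> paths_in Y" "h \<in> paths_in Y" .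
    moreover note homotopic_paths_imp_pathstart[OF calculation(1)]
      homotopic_paths_imp_pathfinish[OF calculation(1)]
    ultimately show "E g = E h"
      unfolding E_def L_def
      by (intro K_homotopic) (auto intro!: homotopic_paths_join homotopic_paths_refl_in
          simp: \<tau> paths_inD)
  qed
  then interpret path_functor ?G Y E .
  have E_loop: "E g = K g" if "g \<in> loops_at Y p" for g
  proof -
    have g: "g \<in> paths_in Y" "pathstart g = p" "pathfinish g = p"
      using that by (auto simp: loops_at_iff)
    have "homotopic_paths Y (L g) ((\<lambda>_. p) +++ g)"
      using g p homotopic_paths_const_right[of g Y]
      by (auto simp: L_def \<tau>(4) reversepath_def intro!: homotopic_paths_join homotopic_paths_refl_in)
    also have "homotopic_paths Y \<dots> g"
      using g homotopic_paths_const_left[of g Y] by simp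
    finally show ?thesis
      by (simp add: E_def K_homotopic)
  qed
  have E_small: "E g = \<one>\<^bsub>?G\<^esub>"
    if "c \<in> Y" "g \<in> paths_in (Y \<inter> ball c \<delta>)" "pathfinish g = pathstart g" for c g
  proof -
    have g: "g \<in> paths_in Y"
      using that by (auto intro: paths_in_mono)
    have "path_class Y (L g) \<in> ?N"
      unfolding small_loop_subgroup_alt L_def that(3)
      using that g \<tau> paths_inD[OF g] by (intro normal_closure_incl[THEN subsetD]) blast
    then show ?thesis
      using N.rcos_const by (simp add: E_def K_def delta_group_def)
  qed
  show thesis
  proof (rule that[OF E_functor])
    show "E ` loops_at Y p = carrier ?G"
      by (simp add: carrier E_loop)
    fix c g h
    assume *: "c \<in> Y" "g \<in> paths_in (Y \<inter> ball c \<delta>)" "h \<in> paths_in (Y \<inter> ball c \<delta>)"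
      "pathstart g = pathstart h" "pathfinish g = pathfinish h"
    then have "E (g +++ reversepath h) = \<one>\<^bsub>?G\<^esub>"
      by (intro E_small[of c]) auto
    moreover have gh: "g \<in> paths_in Y" "h \<in> paths_in Y"
      using * by (auto intro: paths_in_mono)
    ultimately have "E g \<otimes>\<^bsub>?G\<^esub> inv\<^bsub>?G\<^esub> E h = \<one>\<^bsub>?G\<^esub>"
      using * by (simp add: join reverse)
    then show "E g = E h"
      using gh G.inv_equality[of "E g" "inv\<^bsub>?G\<^esub> E h"] by simp
  qed
qed

definition first_half :: "(real \<Rightarrow> 'a) \<Rightarrow> real \<Rightarrow> 'a" where
  "first_half g = (\<lambda>t. g (t / 2))"

definition second_half :: "(real \<Rightarrow> 'a) \<Rightarrow> real \<Rightarrow> 'a" where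
  "second_half g = (\<lambda>t. g ((t + 1) / 2))"

lemma join_halves: "first_half g +++ second_half g = g"
  by (auto simp: first_half_def second_half_def joinpaths_def)

lemma halves_endpoints:
  "first_half g 0 = g 0" "first_half g 1 = second_half g 0" "second_half g 1 = g 1"
  by (auto simp: first_half_def second_half_def)

lemma halves_paths_in:
  assumes "g \<in> paths_in Y"
  shows "first_half g \<in> paths_in Y" "second_half g \<in> paths_in Y"
proof -
  have g: "continuous_on {0..1} g" "\<And>t. t \<in> {0..1} \<Longrightarrow> g t \<in> Y"
    using assms by (auto simp: paths_in_def path_def path_image_def)
  have "continuous_on {0..1} (\<lambda>t. g (t / 2))" "continuous_on {0..1} (\<lambda>t. g ((t + 1) / 2))"
    by (rule continuous_on_compose2[OF g(1)]; force intro!: continuous_intros)+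
  then show "first_half g \<in> paths_in Y" "second_half g \<in> paths_in Y"
    using g(2) by (auto simp: paths_in_def path_def path_image_def first_half_def second_half_def)
qed

definition dyadic_fine :: "real \<Rightarrow> nat \<Rightarrow> (real \<Rightarrow> 'a::metric_space) \<Rightarrow> bool" where
  "dyadic_fine r n g \<longleftrightarrow> (\<forall>s\<in>{0..1}. \<forall>t\<in>{0..1}. \<bar>s - t\<bar> \<le> (1/2) ^ n \<longrightarrow> dist (g s) (g t) < r)"

lemma fine_mono:
  assumes "dyadic_fine r n g" "n \<le> m" "r \<le> q"
  shows "dyadic_fine q m g"
proof -
  have "(1/2::real) ^ m \<le> (1/2) ^ n"
    using assms(2) by (intro power_decreasing) auto
  then show ?thesis
    using assms(1,3) unfolding dyadic_fine_def by (meson order_less_le_trans order_trans)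
qed

lemma fine_halves:
  assumes "dyadic_fine r (Suc n) g"
  shows "dyadic_fine r n (first_half g)" "dyadic_fine r n (second_half g)"
proof -
  have "dist (g (s / 2)) (g (t / 2)) < r" "dist (g ((s + 1) / 2)) (g ((t + 1) / 2)) < r"
    if "s \<in> {0..1}" "t \<in> {0..1}" "\<bar>s - t\<bar> \<le> (1/2) ^ n" for s t
    using that assms by (auto simp: dyadic_fine_def abs_if field_simps split: if_splits)
  then show "dyadic_fine r n (first_half g)" "dyadic_fine r n (second_half g)"
    unfolding dyadic_fine_def first_half_def second_half_def by blast+
qed

lemma uniformly_fine:
  assumes "\<And>s t. \<lbrakk>s \<in> {0..1}; t \<in> {0..1}; \<bar>s - t\<bar> < d\<rbrakk> \<Longrightarrow> dist (g s) (g t) < r" "d > 0"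
  shows "\<exists>n. \<forall>m\<ge>n. dyadic_fine r m g"
proof -
  obtain n where "(1/2) ^ n < d"
    using real_arch_pow_inv[of d "1/2"] assms(2) by auto
  then have "dyadic_fine r n g"
    using assms(1) by (auto simp: dyadic_fine_def)
  then show ?thesis
    using fine_mono by blast
qed

lemma eventually_fine:
  assumes "g \<in> paths_in Y" "r > 0"
  shows "\<exists>n. \<forall>m\<ge>n. dyadic_fine r m g"
proof -
  have "uniformly_continuous_on {0..1} g"
    using assms by (auto intro!: compact_uniformly_continuous simp: paths_in_def path_def)
  then obtain d where "d > 0" "\<And>s t. \<lbrakk>s \<in> {0..1}; t \<in> {0..1}; dist t s < d\<rbrakk> \<Longrightarrow> dist (g t) (g s) < r"
    using assms(2) unfolding uniformly_continuous_on_def by blast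
  then show ?thesis
    by (intro uniformly_fine[of d]) (auto simp: dist_real_def)
qed

lemma path_bisection_induct [consumes 2, case_names small join]:
  assumes "g \<in> paths_in Y" "r > 0"
    and small: "\<And>g. g \<in> paths_in (Y \<inter> ball (pathstart g) r) \<Longrightarrow> P g"
    and join: "\<And>g h. \<lbrakk>g \<in> paths_in Y; h \<in> paths_in Y; pathfinish g = pathstart h; P g; P h\<rbrakk>
                 \<Longrightarrow> P (g +++ h)"
  shows "P g"
proof -
  have "P g" if "g \<in> paths_in Y" "dyadic_fine r n g" for n g
    using that
  proof (induction n arbitrary: g)
    case 0
    then have "path_image g \<subseteq> ball (pathstart g) r"
      by (auto simp: dyadic_fine_def path_image_def pathstart_def)
    with 0 show ?case
      by (intro small) (auto simp: paths_in_def)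
  next
    case (Suc n)
    then show ?case
      using join[of "first_half g" "second_half g"]
      by (simp add: join_halves halves_paths_in fine_halves pathfinish_def pathstart_def halves_endpoints)
  qed
  then show ?thesis
    using assms(1) eventually_fine[OF assms(1,2)] by blast
qed

text \<open>Subdivisions are dyadic, so that refinement and concatenation of paths both reduce to the
  recursion that splits a path into its two halves.\<close>

locale local_cocycle = group G for G :: "('g, 'm) monoid_scheme" (structure) +
  fixes Y :: "'a::metric_space set" and r :: real and c :: "'a \<Rightarrow> 'a \<Rightarrow> 'g"
  assumes r: "r > 0"
    and c_closed: "\<lbrakk>x \<in> Y; y \<in> Y; dist x y < r\<rbrakk> \<Longrightarrow> c x y \<in> carrier G"
    and c_trans: "\<lbrakk>x \<in> Y; y \<in> Y; z \<in> Y; dist x y < r; dist y z < r; dist x z < r\<rbrakk>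
                    \<Longrightarrow> c x y \<otimes> c y z = c x z"
begin

primrec dyadic_prod :: "nat \<Rightarrow> (real \<Rightarrow> 'a) \<Rightarrow> 'g" where
  "dyadic_prod 0 g = c (g 0) (g 1)"
| "dyadic_prod (Suc n) g = dyadic_prod n (first_half g) \<otimes> dyadic_prod n (second_half g)"

definition holonomy :: "(real \<Rightarrow> 'a) \<Rightarrow> 'g" where
  "holonomy g = dyadic_prod (LEAST n. dyadic_fine r n g) g"

lemma c_refl:
  assumes "x \<in> Y"
  shows "c x x = \<one>"
proof -
  have "c x x \<otimes> c x x = c x x"
    using assms r by (intro c_trans) auto
  then show ?thesis
    using assms r c_closed[of x x] by (simp add: l_cancel_one)
qed

lemma endpoints_in: "g \<in> paths_in Y \<Longrightarrow> g 0 \<in> Y \<and> g 1 \<in> Y"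
  by (auto simp: paths_in_def path_image_def)

lemma fine_0: "dyadic_fine q 0 g \<Longrightarrow> dist (g 0) (g 1) < q"
  by (auto simp: dyadic_fine_def)

lemma dyadic_prod_closed: "g \<in> paths_in Y \<Longrightarrow> dyadic_fine r n g \<Longrightarrow> dyadic_prod n g \<in> carrier G"
  by (induction n arbitrary: g)
    (auto simp: halves_paths_in fine_halves intro: c_closed dest: fine_0 endpoints_in)

lemma dyadic_prod_cong: "(\<And>t. t \<in> {0..1} \<Longrightarrow> g t = h t) \<Longrightarrow> dyadic_prod n g = dyadic_prod n h"
proof (induction n arbitrary: g h)
  case (Suc n)
  have "dyadic_prod n (first_half g) = dyadic_prod n (first_half h)"
    "dyadic_prod n (second_half g) = dyadic_prod n (second_half h)"
    by (intro Suc.IH; simp add: first_half_def second_half_def Suc.prems)+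
  then show ?case by simp
qed simp

lemma dyadic_prod_refine:
  assumes "g \<in> paths_in Y" "dyadic_fine r n g"
  shows "dyadic_prod (Suc n) g = dyadic_prod n g"
  using assms
proof (induction n arbitrary: g)
  case 0
  then have "dist (g 0) (g (1/2)) < r" "dist (g (1/2)) (g 1) < r" "dist (g 0) (g 1) < r" "g (1/2) \<in> Y"
    by (auto simp: dyadic_fine_def paths_in_def path_image_def)
  with 0 show ?case
    using endpoints_in[of g] by (simp add: first_half_def second_half_def c_trans)
next
  case (Suc n)
  have "dyadic_prod (Suc n) (first_half g) = dyadic_prod n (first_half g)"
    "dyadic_prod (Suc n) (second_half g) = dyadic_prod n (second_half g)"
    using Suc.prems by (auto intro!: Suc.IH halves_paths_in fine_halves simp del: dyadic_prod.simps)
  then show ?case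
    by (simp only: dyadic_prod.simps(2)[of "Suc n" g] dyadic_prod.simps(2)[of n g])
qed

lemma dyadic_prod_eq:
  assumes "g \<in> paths_in Y" "dyadic_fine r n g" "n \<le> m"
  shows "dyadic_prod m g = dyadic_prod n g"
  using assms(3)
proof (induction m rule: dec_induct)
  case (step m)
  have "dyadic_fine r m g"
    using assms(2) step.hyps(1) by (rule fine_mono) simp
  then show ?case
    using dyadic_prod_refine[OF assms(1)] step.IH by metis
qed simp

lemma holonomy_eq:
  assumes "g \<in> paths_in Y" "dyadic_fine r n g"
  shows "holonomy g = dyadic_prod n g"
  unfolding holonomy_def
  by (rule dyadic_prod_eq[OF assms(1) LeastI[of "\<lambda>n. dyadic_fine r n g", OF assms(2)] Least_le,
        OF assms(2), symmetric])

lemma holonomy_eqE: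
  assumes "g \<in> paths_in Y"
  obtains n where "dyadic_fine r n g" "holonomy g = dyadic_prod n g"
proof -
  obtain n where "\<forall>m\<ge>n. dyadic_fine r m g"
    using eventually_fine[OF assms r] ..
  then have n: "dyadic_fine r n g" by simp
  show thesis
    by (rule that[OF n holonomy_eq[OF assms n]])
qed

lemma holonomy_join:
  assumes "g \<in> paths_in Y" "h \<in> paths_in Y" "pathfinish g = pathstart h"
  shows "holonomy (g +++ h) = holonomy g \<otimes> holonomy h"
proof -
  have gh: "g +++ h \<in> paths_in Y"
    using assms by simp
  obtain k where k: "\<forall>n\<ge>k. dyadic_fine r n g"
    using eventually_fine[OF assms(1) r] ..
  obtain l where l: "\<forall>n\<ge>l. dyadic_fine r n h"
    using eventually_fine[OF assms(2) r] ..
  obtain m where m: "\<forall>n\<ge>m. dyadic_fine r n (g +++ h)"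
    using eventually_fine[OF gh r] ..
  have n: "dyadic_fine r (k + l + m) g" "dyadic_fine r (k + l + m) h" "dyadic_fine r (Suc (k + l + m)) (g +++ h)"
    using k l m by simp_all
  have "first_half (g +++ h) t = g t" "second_half (g +++ h) t = h t" if "t \<in> {0..1}" for t
    using that assms(3)
    by (auto simp: first_half_def second_half_def joinpaths_def pathfinish_def pathstart_def
        add_divide_distrib)
  then show ?thesis
    using holonomy_eq[OF assms(1) n(1)] holonomy_eq[OF assms(2) n(2)] holonomy_eq[OF gh n(3)]
      dyadic_prod_cong[of "first_half (g +++ h)" g] dyadic_prod_cong[of "second_half (g +++ h)" h]
    by simp
qed

lemma dyadic_prod_near:
  assumes "g \<in> paths_in Y" "h \<in> paths_in Y" "dyadic_fine (r/2) n g" "dyadic_fine (r/2) n h"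
    and "\<And>t. t \<in> {0..1} \<Longrightarrow> dist (g t) (h t) < r/2"
  shows "dyadic_prod n g \<otimes> c (g 1) (h 1) = c (g 0) (h 0) \<otimes> dyadic_prod n h"
  using assms
proof (induction n arbitrary: g h)
  case 0
  note d = fine_0[OF 0(3)] fine_0[OF 0(4)] 0(5)[of 0] 0(5)[of 1]
  have "dist (g 0) (h 1) < r"
    using d dist_triangle[of "g 0" "h 1" "g 1"] by simp
  moreover have "dist (g 0) (g 1) < r" "dist (h 0) (h 1) < r" "dist (g 0) (h 0) < r" "dist (g 1) (h 1) < r"
    using d r by auto
  ultimately show ?case
    using endpoints_in[OF 0(1)] endpoints_in[OF 0(2)] by (simp add: c_trans)
next
  case (Suc n)
  note g = halves_paths_in[OF Suc.prems(1)] fine_halves[OF Suc.prems(3)]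
  note h = halves_paths_in[OF Suc.prems(2)] fine_halves[OF Suc.prems(4)]
  have r': "dyadic_fine r n k" if "dyadic_fine (r/2) n k" for k :: "real \<Rightarrow> 'a"
    using fine_mono[OF that, of n r] r by simp
  have near: "dist (first_half g t) (first_half h t) < r/2"
    "dist (second_half g t) (second_half h t) < r/2" if "t \<in> {0..1}" for t
    using that Suc.prems(5)[of "t / 2"] Suc.prems(5)[of "(t + 1) / 2"]
    by (auto simp: first_half_def second_half_def)
  have cl: "c (g t) (h t) \<in> carrier G" if "t \<in> {0..1}" for t
    using Suc.prems(1,2) Suc.prems(5)[OF that] that r
    by (intro c_closed) (auto simp: paths_in_def path_image_def)
  have closed: "dyadic_prod n (first_half g) \<in> carrier G" "dyadic_prod n (second_half g) \<in> carrier G"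
    "dyadic_prod n (first_half h) \<in> carrier G" "dyadic_prod n (second_half h) \<in> carrier G"
    using g h by (auto intro!: dyadic_prod_closed r')
  have 1: "dyadic_prod n (first_half g) \<otimes> c (g (1/2)) (h (1/2)) = c (g 0) (h 0) \<otimes> dyadic_prod n (first_half h)"
    using Suc.IH[OF g(1) h(1) g(3) h(3) near(1)] by (simp add: first_half_def)
  have 2: "dyadic_prod n (second_half g) \<otimes> c (g 1) (h 1) = c (g (1/2)) (h (1/2)) \<otimes> dyadic_prod n (second_half h)"
    using Suc.IH[OF g(2) h(2) g(4) h(4) near(2)] by (simp add: second_half_def)
  show ?case
    using 1 2 closed cl[of 0] cl[of "1/2"] cl[of 1]
    by (simp add: m_assoc) (simp add: m_assoc[symmetric])
qed

lemma holonomy_near: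
  assumes "g \<in> paths_in Y" "h \<in> paths_in Y" "pathstart g = pathstart h" "pathfinish g = pathfinish h"
    and "\<And>t. t \<in> {0..1} \<Longrightarrow> dist (g t) (h t) < r/2"
  shows "holonomy g = holonomy h"
proof -
  obtain k where k: "\<forall>n\<ge>k. dyadic_fine (r/2) n g"
    using eventually_fine[OF assms(1), of "r/2"] r by auto
  obtain l where l: "\<forall>n\<ge>l. dyadic_fine (r/2) n h"
    using eventually_fine[OF assms(2), of "r/2"] r by auto
  have n: "dyadic_fine (r/2) (k + l) g" "dyadic_fine (r/2) (k + l) h"
    using k l by simp_all
  then have n': "dyadic_fine r (k + l) g" "dyadic_fine r (k + l) h"
    using r fine_mono[of "r/2" "k + l" _ "k + l" r] by simp_all
  show ?thesis
    using dyadic_prod_near[OF assms(1,2) n assms(5)] assms n'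
    by (simp add: holonomy_eq pathstart_def pathfinish_def c_refl dyadic_prod_closed endpoints_in)
qed

lemma holonomy_homotopic:
  assumes "homotopic_paths Y g h"
  shows "holonomy g = holonomy h"
proof -
  obtain H :: "real \<times> real \<Rightarrow> 'a" where H: "continuous_on ({0..1} \<times> {0..1}) H" "H \<in> {0..1} \<times> {0..1} \<rightarrow> Y"
    "\<forall>x\<in>{0..1}. H (0, x) = g x" "\<forall>x\<in>{0..1}. H (1, x) = h x"
    "\<forall>t\<in>{0..1}. pathstart (H \<circ> Pair t) = pathstart g \<and> pathfinish (H \<circ> Pair t) = pathfinish g"
    using assms unfolding homotopic_paths by blast
  define \<gamma> where "\<gamma> s = H \<circ> Pair s" for s
  have \<gamma>: "\<gamma> s \<in> paths_in Y" if "s \<in> {0..1}" for s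
  proof -
    have "continuous_on {0..1} (\<gamma> s)"
      unfolding \<gamma>_def using that
      by (intro continuous_on_compose continuous_intros continuous_on_subset[OF H(1)]) auto
    then show ?thesis
      using H(2) that by (auto simp: paths_in_def path_def path_image_def \<gamma>_def)
  qed
  have "uniformly_continuous_on ({0..1} \<times> {0..1}) H"
    by (intro compact_uniformly_continuous H compact_Times) auto
  then obtain d where d: "d > 0" "\<And>x y. \<lbrakk>x \<in> {0..1} \<times> {0..1}; y \<in> {0..1} \<times> {0..1}; dist y x < d\<rbrakk>
      \<Longrightarrow> dist (H y) (H x) < r/2"
    using r unfolding uniformly_continuous_on_def by (meson half_gt_zero)
  have eq: "holonomy (\<gamma> s) = holonomy (\<gamma> t)" if "s \<in> {0..1}" "t \<in> {0..1}" "dist s t < d" for s t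
  proof (rule holonomy_near)
    show "dist (\<gamma> s x) (\<gamma> t x) < r/2" if "x \<in> {0..1}" for x
      using d(2)[of "(t, x)" "(s, x)"] that \<open>s \<in> {0..1}\<close> \<open>t \<in> {0..1}\<close> \<open>dist s t < d\<close>
      by (simp add: \<gamma>_def dist_Pair_Pair)
  qed (use that H(5) \<gamma> in \<open>simp_all add: \<gamma>_def\<close>)
  have "holonomy (\<gamma> 0) = holonomy (\<gamma> 1)"
  proof (rule connected_local_const[of "{0..1::real}"])
    show "\<forall>s\<in>{0..1}. \<forall>\<^sub>F t in at s within {0..1}. holonomy (\<gamma> s) = holonomy (\<gamma> t)"
    proof
      fix s :: real assume s: "s \<in> {0..1}"
      have "\<forall>t\<in>{0..1}. t \<noteq> s \<and> dist t s < d \<longrightarrow> holonomy (\<gamma> s) = holonomy (\<gamma> t)"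
        using eq[OF s] by (simp only: dist_commute[of _ s]) blast
      then show "\<forall>\<^sub>F t in at s within {0..1}. holonomy (\<gamma> s) = holonomy (\<gamma> t)"
        unfolding eventually_at using d(1) by blast
    qed
  qed simp_all
  moreover have ends: "pathstart (\<gamma> s) = pathstart g" "pathfinish (\<gamma> s) = pathfinish g"
    if "s \<in> {0..1}" for s
    using H(5) that by (simp_all add: \<gamma>_def)
  have "holonomy (\<gamma> 0) = holonomy g"
    by (rule holonomy_near) (use ends[of 0] \<gamma>[of 0] homotopic_paths_in(1)[OF assms] H(3) r in
        \<open>simp_all add: \<gamma>_def\<close>)
  moreover have "holonomy (\<gamma> 1) = holonomy h"
    by (rule holonomy_near) (use ends[of 1] \<gamma>[of 1] homotopic_paths_in(2)[OF assms] H(4) r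
        homotopic_paths_imp_pathstart[OF assms] homotopic_paths_imp_pathfinish[OF assms] in
        \<open>simp_all add: \<gamma>_def\<close>)
  ultimately show ?thesis by simp
qed

lemma holonomy_path_functor: "path_functor G Y holonomy"
proof
  show "holonomy g \<in> carrier G" if "g \<in> paths_in Y" for g
    using holonomy_eqE[OF that] dyadic_prod_closed[OF that] by metis
qed (use holonomy_join holonomy_homotopic in auto)

end

lemma hausdorff_dist_gen_commute:
  "hausdorff_dist_gen (\<lambda>a b. d b a) B A = hausdorff_dist_gen d A B"
  by (simp add: hausdorff_dist_gen_def max.commute)

lemma hausdorff_dist_gen_lessD:
  assumes "hausdorff_dist_gen d A B < e" "a \<in> A"
    and nonneg: "\<And>a b. 0 \<le> d a b" and bounded: "\<And>a b. a \<in> A \<Longrightarrow> b \<in> B \<Longrightarrow> d a b \<le> K"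
    and "B \<noteq> {}"
  shows "\<exists>b\<in>B. d a b < e"
proof -
  obtain b0 where b0: "b0 \<in> B"
    using assms by blast
  have bdd: "bdd_below (d a ` B)" for a
    using nonneg by (auto intro!: bdd_belowI)
  have "(INF b\<in>B. d a b) \<le> K" if "a \<in> A" for a
    using cINF_lower[OF bdd[of a] b0] bounded[OF that b0] by linarith
  then have "(INF b\<in>B. d a b) \<le> (SUP a\<in>A. INF b\<in>B. d a b)"
    using assms(2) by (intro cSUP_upper bdd_aboveI[of _ K]) auto
  also have "\<dots> < e"
    using assms(1) by (simp add: hausdorff_dist_gen_def)
  finally show ?thesis
    using cINF_less_iff[OF assms(5) bdd] by blast
qed

lemma admissible_metric_exists:
  fixes Y1 :: "'a::metric_space set" and Y2 :: "'b::metric_space set"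
  assumes "bounded Y1" "bounded Y2"
  shows "\<exists>d. admissible_metric Y1 Y2 d"
proof -
  obtain K1 where K1: "\<And>x y. x \<in> Y1 \<Longrightarrow> y \<in> Y1 \<Longrightarrow> dist x y \<le> K1"
    using assms(1) unfolding bounded_two_points by blast
  obtain K2 where K2: "\<And>x y. x \<in> Y2 \<Longrightarrow> y \<in> Y2 \<Longrightarrow> dist x y \<le> K2"
    using assms(2) unfolding bounded_two_points by blast
  define D where "D = \<bar>K1\<bar> + \<bar>K2\<bar> + 1"
  have D: "D > 0" "\<And>x y. x \<in> Y1 \<Longrightarrow> y \<in> Y1 \<Longrightarrow> dist x y \<le> D + D"
    "\<And>x y. x \<in> Y2 \<Longrightarrow> y \<in> Y2 \<Longrightarrow> dist x y \<le> D + D"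
    using K1 K2 by (force simp: D_def)+
  define d :: "'a + 'b \<Rightarrow> 'a + 'b \<Rightarrow> real" where
    "d u v = (case (u, v) of (Inl x, Inl y) \<Rightarrow> dist x y | (Inr x, Inr y) \<Rightarrow> dist x y | _ \<Rightarrow> D)" for u v
  have "Metric_space (Inl ` Y1 \<union> Inr ` Y2) d"
  proof
    show "0 \<le> d u v" "d u v = d v u" for u v
      using D(1) by (auto simp: d_def dist_commute split: sum.splits)
    show "d u v = 0 \<longleftrightarrow> u = v" if "u \<in> Inl ` Y1 \<union> Inr ` Y2" "v \<in> Inl ` Y1 \<union> Inr ` Y2" for u v
      using that D(1) by (auto simp: d_def)
    show "d u w \<le> d u v + d v w" if "u \<in> Inl ` Y1 \<union> Inr ` Y2" "v \<in> Inl ` Y1 \<union> Inr ` Y2"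
      "w \<in> Inl ` Y1 \<union> Inr ` Y2" for u v w
      using that D by (auto simp: d_def dist_triangle)
  qed
  then show ?thesis
    by (intro exI[of _ d]) (simp add: admissible_metric_def d_def)
qed

lemma GH_dist_lessE:
  fixes Y1 :: "'a::metric_space set" and Y2 :: "'b::metric_space set"
  assumes "bounded Y1" "bounded Y2" "Y1 \<noteq> {}" "Y2 \<noteq> {}" "GH_dist Y1 Y2 < e"
  obtains d f g where "admissible_metric Y1 Y2 d"
    and "\<And>x. x \<in> Y1 \<Longrightarrow> f x \<in> Y2 \<and> d (Inl x) (Inr (f x)) < e"
    and "\<And>y. y \<in> Y2 \<Longrightarrow> g y \<in> Y1 \<and> d (Inl (g y)) (Inr y) < e"
proof -
  obtain d where adm: "admissible_metric Y1 Y2 d" and less: "hausdorff_dist_gen d (Inl ` Y1) (Inr ` Y2) < e"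
    using cInf_lessD[OF _ assms(5)[unfolded GH_dist_def]] admissible_metric_exists[OF assms(1,2)] by blast
  interpret Metric_space "Inl ` Y1 \<union> Inr ` Y2" d
    using adm by (simp add: admissible_metric_def)
  obtain K1 where K1: "\<And>x y. x \<in> Y1 \<Longrightarrow> y \<in> Y1 \<Longrightarrow> dist x y \<le> K1"
    using assms(1) unfolding bounded_two_points by blast
  obtain K2 where K2: "\<And>x y. x \<in> Y2 \<Longrightarrow> y \<in> Y2 \<Longrightarrow> dist x y \<le> K2"
    using assms(2) unfolding bounded_two_points by blast
  obtain x0 y0 where 0: "x0 \<in> Y1" "y0 \<in> Y2"
    using assms by blast
  have bound: "d (Inl x) (Inr y) \<le> K1 + d (Inl x0) (Inr y0) + K2" if "x \<in> Y1" "y \<in> Y2" for x y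
  proof -
    have "d (Inl x) (Inr y) \<le> d (Inl x) (Inl x0) + d (Inl x0) (Inr y)"
      "d (Inl x0) (Inr y) \<le> d (Inl x0) (Inr y0) + d (Inr y0) (Inr y)"
      using that 0 by (auto intro!: triangle)
    moreover have "d (Inl x) (Inl x0) \<le> K1" "d (Inr y0) (Inr y) \<le> K2"
      using that 0 adm K1 K2 by (auto simp: admissible_metric_def)
    ultimately show ?thesis by linarith
  qed
  have "\<exists>y\<in>Y2. d (Inl x) (Inr y) < e" if "x \<in> Y1" for x
    using hausdorff_dist_gen_lessD[OF less, of "Inl x"] bound that assms(4) by auto
  then obtain f where f: "\<And>x. x \<in> Y1 \<Longrightarrow> f x \<in> Y2 \<and> d (Inl x) (Inr (f x)) < e"
    by metis
  have less': "hausdorff_dist_gen (\<lambda>a b. d b a) (Inr ` Y2) (Inl ` Y1) < e"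
    using less hausdorff_dist_gen_commute[of d "Inr ` Y2" "Inl ` Y1"] by linarith
  have "\<exists>x\<in>Y1. d (Inl x) (Inr y) < e" if "y \<in> Y2" for y
    using hausdorff_dist_gen_lessD[OF less', of "Inr y"] bound that assms(3) by auto
  then obtain g where g: "\<And>y. y \<in> Y2 \<Longrightarrow> g y \<in> Y1 \<and> d (Inl (g y)) (Inr y) < e"
    by metis
  show thesis
    by (rule that[OF adm f g])
qed

lemma length_space_short_path:
  fixes Y :: "'a::metric_space set"
  assumes "length_space Y" "x \<in> Y" "y \<in> Y" "dist x y < R"
  shows "\<exists>g \<in> paths_in (Y \<inter> ball x R). pathstart g = x \<and> pathfinish g = y"
proof -
  have "ereal (dist x y) =
      (INF g \<in> {g. path g \<and> path_image g \<subseteq> Y \<and> pathstart g = x \<and> pathfinish g = y}. curve_length g)"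
    using assms(1-3) unfolding length_space_def by blast
  then have "(INF g \<in> {g. path g \<and> path_image g \<subseteq> Y \<and> pathstart g = x \<and> pathfinish g = y}. curve_length g) < ereal R"
    using assms(4) by (auto dest: sym)
  then obtain g where g: "path g" "path_image g \<subseteq> Y" "pathstart g = x" "pathfinish g = y"
    and len: "curve_length g < ereal R"
    unfolding INF_less_iff by blast
  have "dist x (g t) < R" if t: "t \<in> {0..1}" for t
  proof -
    define p where "p i = (if i = 0 then 0 else if i = 1 then t else 1)" for i :: nat
    have "(2, p) \<in> {(n, t). t 0 = 0 \<and> t n = 1 \<and> (\<forall>i<n. t i \<le> t (Suc i))}"
      using t by (auto simp: p_def less_Suc_eq numeral_2_eq_2)
    then have "ereal (\<Sum>i<2. dist (g (p i)) (g (p (Suc i)))) \<le> curve_length g"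
      unfolding curve_length_def by (rule SUP_upper2) simp
    also have "(\<Sum>i<2. dist (g (p i)) (g (p (Suc i)))) = dist x (g t) + dist (g t) y"
      using g by (simp add: p_def numeral_2_eq_2 pathstart_def pathfinish_def)
    finally have "ereal (dist x (g t) + dist (g t) y) < ereal R"
      using len by (rule le_less_trans)
    then have "dist x (g t) + dist (g t) y < R"
      by simp
    then show ?thesis
      using zero_le_dist[of "g t" y] by linarith
  qed
  then have "g \<in> paths_in (Y \<inter> ball x R)"
    using g by (auto simp: paths_in_def path_image_def)
  with g show ?thesis by blast
qed

lemma length_space_imp_path_connected:
  assumes "length_space Y"
  shows "path_connected Y"
  unfolding path_connected_def
proof (intro ballI)
  fix x y assume "x \<in> Y" "y \<in> Y"
  then obtain g where "g \<in> paths_in (Y \<inter> ball x (dist x y + 1))" "pathstart g = x" "pathfinish g = y"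
    using length_space_short_path[OF assms, of x y "dist x y + 1"] by auto
  then show "\<exists>g. path g \<and> path_image g \<subseteq> Y \<and> pathstart g = x \<and> pathfinish g = y"
    by (auto simp: paths_in_def)
qed

lemma delta_group_epi_of_coarse_maps:
  fixes Y1 :: "'a::metric_space set" and Y2 :: "'b::metric_space set"
  assumes Y1: "length_space Y1" and Y2: "length_space Y2"
    and e: "e > 0" "\<delta>1 \<ge> 5 * e" "\<delta>2 \<ge> \<delta>1 + 5 * e"
    and f: "\<And>x. x \<in> Y1 \<Longrightarrow> f x \<in> Y2"
      "\<And>x x'. x \<in> Y1 \<Longrightarrow> x' \<in> Y1 \<Longrightarrow> dist (f x) (f x') < dist x x' + 2 * e"
    and g: "\<And>y. y \<in> Y2 \<Longrightarrow> g y \<in> Y1"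
      "\<And>y y'. y \<in> Y2 \<Longrightarrow> y' \<in> Y2 \<Longrightarrow> dist (g y) (g y') < dist y y' + 2 * e"
      "\<And>y. y \<in> Y2 \<Longrightarrow> dist y (f (g y)) < 2 * e"
    and p: "p1 \<in> Y1" "p2 \<in> Y2"
  shows "\<exists>\<Phi> \<in> hom (delta_group Y1 \<delta>1 p1) (delta_group Y2 \<delta>2 p2).
           \<Phi> ` carrier (delta_group Y1 \<delta>1 p1) = carrier (delta_group Y2 \<delta>2 p2)"
proof -
  define G where "G = delta_group Y2 \<delta>2 p2"
  obtain E where "path_functor G Y2 E" and E_surj: "E ` loops_at Y2 p2 = carrier G"
    and E_small: "\<And>c g h. \<lbrakk>c \<in> Y2; g \<in> paths_in (Y2 \<inter> ball c \<delta>2); h \<in> paths_in (Y2 \<inter> ball c \<delta>2);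
            pathstart g = pathstart h; pathfinish g = pathfinish h\<rbrakk> \<Longrightarrow> E g = E h"
    unfolding G_def by (rule delta_group_path_functor[OF length_space_imp_path_connected[OF Y2] p(2), of \<delta>2]) (rule that[unfolded G_def])
  interpret E: path_functor G Y2 E by fact
  have ball_mono: "h \<in> paths_in (Y2 \<inter> ball y R)" if "h \<in> paths_in (Y2 \<inter> ball x q)" "dist y x + q \<le> R" for h x y q R
    using that(1) by (rule paths_in_mono) (use that(2) in \<open>auto simp: ball_subset_ball_iff\<close>,
        smt (verit) dist_triangle)
  have "\<exists>h \<in> paths_in (Y2 \<inter> ball (f x) (3 * e)). pathstart h = f x \<and> pathfinish h = f x'"
    if "x \<in> Y1" "x' \<in> Y1" "dist x x' < e" for x x'
    using that f(1)[of x] f(1)[of x'] f(2)[of x x'] by (intro length_space_short_path[OF Y2]) auto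
  then obtain s where "\<And>x x'. x \<in> Y1 \<Longrightarrow> x' \<in> Y1 \<Longrightarrow> dist x x' < e \<Longrightarrow>
      s x x' \<in> paths_in (Y2 \<inter> ball (f x) (3 * e)) \<and> pathstart (s x x') = f x \<and> pathfinish (s x x') = f x'"
    by metis
  then have s: "s x x' \<in> paths_in (Y2 \<inter> ball (f x) (3 * e))"
    "pathstart (s x x') = f x" "pathfinish (s x x') = f x'"
    if "x \<in> Y1" "x' \<in> Y1" "dist x x' < e" for x x'
    using that by blast+
  define c where "c x x' = E (s x x')" for x x'
  have s_in: "s x x' \<in> paths_in Y2" if "x \<in> Y1" "x' \<in> Y1" "dist x x' < e" for x x'
    using s(1)[OF that] by (rule paths_in_mono) auto
  interpret local_cocycle G Y1 e c
  proof
    show "c x x' \<in> carrier G" if "x \<in> Y1" "x' \<in> Y1" "dist x x' < e" for x x'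
      using s_in[OF that] by (simp add: c_def)
    show "c x y \<otimes>\<^bsub>G\<^esub> c y z = c x z"
      if *: "x \<in> Y1" "y \<in> Y1" "z \<in> Y1" "dist x y < e" "dist y z < e" "dist x z < e" for x y z
    proof -
      have "s x y \<in> paths_in (Y2 \<inter> ball (f x) \<delta>2)" "s y z \<in> paths_in (Y2 \<inter> ball (f x) \<delta>2)"
        "s x z \<in> paths_in (Y2 \<inter> ball (f x) \<delta>2)"
        using * s(1)[of x y] s(1)[of y z] s(1)[of x z] f(2)[of x y] e by (auto elim!: ball_mono)
      then have "E (s x y +++ s y z) = E (s x z)"
        using * f(1) by (intro E_small[of "f x"]) (auto simp: s)
      then show ?thesis
        using * by (simp add: c_def E.join s_in s)
    qed
  qed (rule e)
  interpret F: path_functor G Y1 holonomy by (rule holonomy_path_functor)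
  have shadow: "\<exists>S \<in> paths_in (Y2 \<inter> ball (f z) (R + 5 * e)).
      pathstart S = f (pathstart \<gamma>) \<and> pathfinish S = f (pathfinish \<gamma>) \<and> holonomy \<gamma> = E S"
    if z: "z \<in> Y1" and \<gamma>: "\<gamma> \<in> paths_in (Y1 \<inter> ball z R)" for z R \<gamma>
  proof -
    have "\<exists>S \<in> paths_in (Y2 \<inter> ball (f z) (R + 5 * e)).
      pathstart S = f (\<gamma> 0) \<and> pathfinish S = f (\<gamma> 1) \<and> dyadic_prod n \<gamma> = E S"
      if "\<gamma> \<in> paths_in (Y1 \<inter> ball z R)" "dyadic_fine e n \<gamma>" for n \<gamma>
      using that
    proof (induction n arbitrary: \<gamma>)
      case 0
      have *: "\<gamma> 0 \<in> Y1" "\<gamma> 1 \<in> Y1" "dist z (\<gamma> 0) < R" "dist (\<gamma> 0) (\<gamma> 1) < e"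
        using paths_inD(3,4)[OF 0(1)] fine_0[OF 0(2)] by (auto simp: pathstart_def pathfinish_def)
      then have "s (\<gamma> 0) (\<gamma> 1) \<in> paths_in (Y2 \<inter> ball (f z) (R + 5 * e))"
        using f(2)[OF z, of "\<gamma> 0"] by (intro ball_mono[OF s(1)]) auto
      moreover have "dyadic_prod 0 \<gamma> = E (s (\<gamma> 0) (\<gamma> 1))"
        by (simp only: dyadic_prod.simps(1) c_def[of "\<gamma> 0" "\<gamma> 1"])
      ultimately show ?case
        using * s by blast
    next
      case (Suc n)
      obtain S where S: "S \<in> paths_in (Y2 \<inter> ball (f z) (R + 5 * e))" "pathstart S = f (\<gamma> 0)"
        "pathfinish S = f (second_half \<gamma> 0)" "dyadic_prod n (first_half \<gamma>) = E S"
        using Suc.IH[of "first_half \<gamma>"] Suc.prems by (auto simp: halves_paths_in fine_halves halves_endpoints)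
      obtain T where T: "T \<in> paths_in (Y2 \<inter> ball (f z) (R + 5 * e))" "pathstart T = f (second_half \<gamma> 0)"
        "pathfinish T = f (\<gamma> 1)" "dyadic_prod n (second_half \<gamma>) = E T"
        using Suc.IH[of "second_half \<gamma>"] Suc.prems by (auto simp: halves_paths_in fine_halves halves_endpoints)
      have "S \<in> paths_in Y2" "T \<in> paths_in Y2"
        using S T by (auto intro: paths_in_mono)
      then show ?case
        using S T by (intro bexI[of _ "S +++ T"]) (auto simp: E.join)
    qed
    moreover obtain n where "dyadic_fine e n \<gamma>" "holonomy \<gamma> = dyadic_prod n \<gamma>"
      using \<gamma> by (elim holonomy_eqE[OF paths_in_mono]) auto
    ultimately show ?thesis
      using \<gamma> by (simp add: pathstart_def pathfinish_def)
  qed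
  have small: "holonomy \<beta> = \<one>\<^bsub>G\<^esub>"
    if x: "x \<in> Y1" and \<beta>: "\<beta> \<in> paths_in (Y1 \<inter> ball x \<delta>1)" "pathfinish \<beta> = pathstart \<beta>" for x \<beta>
  proof -
    obtain S where S: "S \<in> paths_in (Y2 \<inter> ball (f x) (\<delta>1 + 5 * e))"
      "pathstart S = f (pathstart \<beta>)" "pathfinish S = f (pathstart \<beta>)" "holonomy \<beta> = E S"
      using shadow[OF x \<beta>(1)] \<beta>(2) by auto
    have S': "S \<in> paths_in (Y2 \<inter> ball (f x) \<delta>2)"
      using S(1) e by (auto elim!: ball_mono)
    then have "E S = E (\<lambda>_. pathstart S)"
      using S f(1) x paths_inD[OF S'] by (intro E_small[of "f x"]) auto
    then show ?thesis
      using S(4) paths_inD(3)[OF S'] by (simp add: E.const)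
  qed
  have "\<exists>h \<in> paths_in (Y2 \<inter> ball y (2 * e)). pathstart h = y \<and> pathfinish h = f (g y)" if "y \<in> Y2" for y
    using that f g by (intro length_space_short_path[OF Y2]) auto
  then obtain u where "\<And>y. y \<in> Y2 \<Longrightarrow>
      u y \<in> paths_in (Y2 \<inter> ball y (2 * e)) \<and> pathstart (u y) = y \<and> pathfinish (u y) = f (g y)"
    by metis
  then have u: "u y \<in> paths_in (Y2 \<inter> ball y (2 * e))" "pathstart (u y) = y"
    "pathfinish (u y) = f (g y)" if "y \<in> Y2" for y
    using that by blast+
  have u_in: "u y \<in> paths_in Y2" if "y \<in> Y2" for y
    using u(1)[OF that] by (rule paths_in_mono) auto
  have lift: "\<exists>\<gamma>' \<in> paths_in Y1. pathstart \<gamma>' = g (pathstart \<gamma>) \<and> pathfinish \<gamma>' = g (pathfinish \<gamma>) \<and>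
      E (u (pathstart \<gamma>)) \<otimes>\<^bsub>G\<^esub> holonomy \<gamma>' = E \<gamma> \<otimes>\<^bsub>G\<^esub> E (u (pathfinish \<gamma>))" if "\<gamma> \<in> paths_in Y2" for \<gamma>
    using that e(1)
  proof (induction \<gamma> rule: path_bisection_induct)
    case (small \<gamma>)
    define y z where "y = pathstart \<gamma>" and "z = pathfinish \<gamma>"
    have yz: "y \<in> Y2" "z \<in> Y2" "dist y z < e"
      using paths_inD(3,4)[OF small] by (auto simp: y_def z_def)
    have \<gamma>: "\<gamma> \<in> paths_in Y2"
      using small by (rule paths_in_mono) auto
    have "dist (g y) (g z) < 3 * e"
      using g(2)[of y z] yz by auto
    then obtain \<gamma>' where \<gamma>': "\<gamma>' \<in> paths_in (Y1 \<inter> ball (g y) (3 * e))" "pathstart \<gamma>' = g y" "pathfinish \<gamma>' = g z"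
      using length_space_short_path[OF Y1 g(1) g(1)] yz by blast
    then have \<gamma>'_in: "\<gamma>' \<in> paths_in Y1"
      by (auto intro: paths_in_mono)
    obtain S where S: "S \<in> paths_in (Y2 \<inter> ball (f (g y)) (3 * e + 5 * e))"
      "pathstart S = f (g y)" "pathfinish S = f (g z)" "holonomy \<gamma>' = E S"
      using shadow[OF g(1) \<gamma>'(1)] yz \<gamma>' by auto
    have S_in: "S \<in> paths_in Y2"
      using S(1) by (rule paths_in_mono) auto
    have "E (u y +++ S) = E (\<gamma> +++ u z)"
    proof (rule E_small[of y])
      show "u y +++ S \<in> paths_in (Y2 \<inter> ball y \<delta>2)"
        using yz S e g(3)[of y] u[of y] by (auto intro!: paths_in_join elim!: ball_mono)
      show "\<gamma> +++ u z \<in> paths_in (Y2 \<inter> ball y \<delta>2)"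
        using yz small e u[of z] by (auto intro!: paths_in_join elim!: ball_mono simp: y_def z_def)
    qed (use yz S u in \<open>auto simp: y_def z_def\<close>)
    then have "E (u y) \<otimes>\<^bsub>G\<^esub> holonomy \<gamma>' = E \<gamma> \<otimes>\<^bsub>G\<^esub> E (u z)"
      using yz S u u_in \<gamma> S_in by (simp add: E.join z_def)
    then show ?case
      using \<gamma>' \<gamma>'_in unfolding y_def z_def by blast
  next
    case (join \<gamma> \<eta>)
    obtain \<gamma>' where \<gamma>': "\<gamma>' \<in> paths_in Y1" "pathstart \<gamma>' = g (pathstart \<gamma>)" "pathfinish \<gamma>' = g (pathfinish \<gamma>)"
      "E (u (pathstart \<gamma>)) \<otimes>\<^bsub>G\<^esub> holonomy \<gamma>' = E \<gamma> \<otimes>\<^bsub>G\<^esub> E (u (pathfinish \<gamma>))"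
      using join.IH(1) by blast
    obtain \<eta>' where \<eta>': "\<eta>' \<in> paths_in Y1" "pathstart \<eta>' = g (pathstart \<eta>)" "pathfinish \<eta>' = g (pathfinish \<eta>)"
      "E (u (pathstart \<eta>)) \<otimes>\<^bsub>G\<^esub> holonomy \<eta>' = E \<eta> \<otimes>\<^bsub>G\<^esub> E (u (pathfinish \<eta>))"
      using join.IH(2) by blast
    note closed = E.closed[OF join.hyps(1)] E.closed[OF join.hyps(2)] F.closed[OF \<gamma>'(1)] F.closed[OF \<eta>'(1)]
      E.closed[OF u_in[OF paths_inD(3)[OF join.hyps(1)]]] E.closed[OF u_in[OF paths_inD(4)[OF join.hyps(1)]]]
      E.closed[OF u_in[OF paths_inD(4)[OF join.hyps(2)]]]
    have "E (u (pathstart \<gamma>)) \<otimes>\<^bsub>G\<^esub> (holonomy \<gamma>' \<otimes>\<^bsub>G\<^esub> holonomy \<eta>')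
        = E \<gamma> \<otimes>\<^bsub>G\<^esub> (E (u (pathstart \<eta>)) \<otimes>\<^bsub>G\<^esub> holonomy \<eta>')"
      using \<gamma>'(4) closed join.hyps(3) by (simp add: E.m_assoc[symmetric])
    also have "\<dots> = E \<gamma> \<otimes>\<^bsub>G\<^esub> E \<eta> \<otimes>\<^bsub>G\<^esub> E (u (pathfinish \<eta>))"
      unfolding \<eta>'(4) using closed by (simp add: E.m_assoc)
    finally show ?case
      using \<gamma>' \<eta>' join.hyps by (intro bexI[of _ "\<gamma>' +++ \<eta>'"]) (simp_all add: E.join F.join)
  qed
  have surj: "holonomy ` loops_at Y1 p1 = carrier G"
  proof (intro equalityI subsetI)
    fix z assume z: "z \<in> carrier G"
    obtain \<rho> where \<rho>: "\<rho> \<in> paths_in Y1" "pathstart \<rho> = p1" "pathfinish \<rho> = g p2"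
      using length_space_imp_path_connected[OF Y1] p g(1)[of p2]
      unfolding path_connected_def paths_in_def by blast
    define a b where "a = E (u p2)" and "b = holonomy \<rho>"
    have ab: "a \<in> carrier G" "b \<in> carrier G"
      using \<rho> p u_in by (auto simp: a_def b_def)
    have "a \<otimes>\<^bsub>G\<^esub> (inv\<^bsub>G\<^esub> b \<otimes>\<^bsub>G\<^esub> z \<otimes>\<^bsub>G\<^esub> b) \<otimes>\<^bsub>G\<^esub> inv\<^bsub>G\<^esub> a \<in> carrier G"
      using ab z by simp
    then obtain \<gamma> where \<gamma>: "\<gamma> \<in> loops_at Y2 p2" "E \<gamma> = a \<otimes>\<^bsub>G\<^esub> (inv\<^bsub>G\<^esub> b \<otimes>\<^bsub>G\<^esub> z \<otimes>\<^bsub>G\<^esub> b) \<otimes>\<^bsub>G\<^esub> inv\<^bsub>G\<^esub> a"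
      unfolding E_surj[symmetric] by auto
    then obtain \<gamma>' where \<gamma>': "\<gamma>' \<in> paths_in Y1" "pathstart \<gamma>' = g p2" "pathfinish \<gamma>' = g p2"
      "a \<otimes>\<^bsub>G\<^esub> holonomy \<gamma>' = E \<gamma> \<otimes>\<^bsub>G\<^esub> a"
      using lift[of \<gamma>] by (auto simp: loops_at_iff a_def)
    have "a \<otimes>\<^bsub>G\<^esub> holonomy \<gamma>' = a \<otimes>\<^bsub>G\<^esub> (inv\<^bsub>G\<^esub> b \<otimes>\<^bsub>G\<^esub> z \<otimes>\<^bsub>G\<^esub> b)"
      unfolding \<gamma>'(4) \<gamma>(2) using ab z by (simp add: E.m_assoc)
    then have "holonomy \<gamma>' = inv\<^bsub>G\<^esub> b \<otimes>\<^bsub>G\<^esub> z \<otimes>\<^bsub>G\<^esub> b"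
      using ab z \<gamma>'(1) by simp
    then have "holonomy (\<rho> +++ \<gamma>' +++ reversepath \<rho>) = z"
      using \<rho> \<gamma>' ab z by (simp add: F.lasso E.m_assoc flip: b_def) (simp flip: E.m_assoc)
    moreover have "\<rho> +++ \<gamma>' +++ reversepath \<rho> \<in> loops_at Y1 p1"
      using \<rho> \<gamma>' by (intro lasso_in_loops_at) auto
    ultimately show "z \<in> holonomy ` loops_at Y1 p1"
      by blast
  qed (auto simp: loops_at_iff)
  have "\<exists>\<Phi> \<in> hom (delta_group Y1 \<delta>1 p1) G. \<Phi> ` carrier (delta_group Y1 \<delta>1 p1) = holonomy ` loops_at Y1 p1"
    by (rule path_functor_hom_delta_group[OF holonomy_path_functor p(1)]) (rule small)
  then show ?thesis
    unfolding surj unfolding G_def .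
qed

theorem theorem3p4:
  fixes Y1 :: "'a::metric_space set" and Y2 :: "'b::metric_space set"
    and \<epsilon> \<delta>1 \<delta>2 :: real and p1 :: 'a and p2 :: 'b
  assumes "compact Y1" "length_space Y1"
    and "compact Y2" "length_space Y2"
    and "GH_dist Y1 Y2 \<le> \<epsilon>"
    and "\<delta>1 > 20 * \<epsilon>" and "\<delta>2 > \<delta>1 + 10 * \<epsilon>"
    and "p1 \<in> Y1" and "p2 \<in> Y2"
  shows "\<exists>\<Phi>. \<Phi> \<in> hom (delta_group Y1 \<delta>1 p1) (delta_group Y2 \<delta>2 p2) \<and>
             \<Phi> ` carrier (delta_group Y1 \<delta>1 p1) = carrier (delta_group Y2 \<delta>2 p2)"
proof -
  define e where "e = min (\<delta>1 / 20) ((\<delta>2 - \<delta>1) / 10)"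
  have "GH_dist Y1 Y2 < e"
    using assms by (auto simp: e_def min_def)
  then obtain d f g where adm: "admissible_metric Y1 Y2 d"
    and f: "\<And>x. x \<in> Y1 \<Longrightarrow> f x \<in> Y2 \<and> d (Inl x) (Inr (f x)) < e"
    and g: "\<And>y. y \<in> Y2 \<Longrightarrow> g y \<in> Y1 \<and> d (Inl (g y)) (Inr y) < e"
    using assms by (elim GH_dist_lessE[rotated -1]) (auto intro: compact_imp_bounded)
  interpret Metric_space "Inl ` Y1 \<union> Inr ` Y2" d
    using adm by (simp add: admissible_metric_def)
  have d: "d (Inl x) (Inl x') = dist x x'" if "x \<in> Y1" "x' \<in> Y1" for x x'
    using adm that by (simp add: admissible_metric_def)
  have d': "d (Inr y) (Inr y') = dist y y'" if "y \<in> Y2" "y' \<in> Y2" for y y'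
    using adm that by (simp add: admissible_metric_def)
  have "e > 0"
    using f[of p1] assms(8) nonneg[of "Inl p1" "Inr (f p1)"] by linarith
  moreover have "20 * e \<le> \<delta>1" "10 * e \<le> \<delta>2 - \<delta>1"
    by (auto simp: e_def min_def field_simps)
  ultimately have e: "e > 0" "\<delta>1 \<ge> 5 * e" "\<delta>2 \<ge> \<delta>1 + 5 * e"
    by linarith+
  have f_dist: "dist (f x) (f x') < dist x x' + 2 * e" if "x \<in> Y1" "x' \<in> Y1" for x x'
  proof -
    have "d (Inr (f x)) (Inr (f x')) \<le> d (Inr (f x)) (Inl x) + d (Inl x) (Inr (f x'))"
      "d (Inl x) (Inr (f x')) \<le> d (Inl x) (Inl x') + d (Inl x') (Inr (f x'))"
      using that f by (auto intro!: triangle)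
    then show ?thesis
      using that f[of x] f[of x'] d[of x x'] d'[of "f x" "f x'"] commute[of "Inr (f x)" "Inl x"] by simp
  qed
  have g_dist: "dist (g y) (g y') < dist y y' + 2 * e" if "y \<in> Y2" "y' \<in> Y2" for y y'
  proof -
    have "d (Inl (g y)) (Inl (g y')) \<le> d (Inl (g y)) (Inr y) + d (Inr y) (Inl (g y'))"
      "d (Inr y) (Inl (g y')) \<le> d (Inr y) (Inr y') + d (Inr y') (Inl (g y'))"
      using that g by (auto intro!: triangle)
    then show ?thesis
      using that g[of y] g[of y'] d[of "g y" "g y'"] d'[of y y'] commute[of "Inr y'" "Inl (g y')"] by simp
  qed
  have fg_dist: "dist y (f (g y)) < 2 * e" if "y \<in> Y2" for y
  proof -
    have "d (Inr y) (Inr (f (g y))) \<le> d (Inr y) (Inl (g y)) + d (Inl (g y)) (Inr (f (g y)))"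
      using that f g by (auto intro!: triangle)
    then show ?thesis
      using that f[of "g y"] g[of y] d'[of y "f (g y)"] commute[of "Inr y" "Inl (g y)"] by simp
  qed
  show ?thesis
    using delta_group_epi_of_coarse_maps[OF assms(2,4) e _ f_dist _ g_dist fg_dist assms(8,9)] f g
    by blast
qed

end
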